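(* Let $\alpha_1,\alpha_2$ be real numbers, let $b_n,c_n,d_n$ be the recurrence coefficients of the multiple Laguerre polynomials of the first kind given in the context, and let $T_m$ be the corresponding tetradiagonal matrices. For $n\ge0$ set $$a_{6n+1}=\alpha_1+1+n,\quad a_{6n+2}=\alpha_2-\alpha_1+n,\quad a_{6n+3}=\alpha_1-\alpha_2+n+1,$$ $$a_{6n+4}=\alpha_2+1+n,\quad a_{6n+5}=n+1,\quad a_{6n+6}=n+1.$$ Then for every $m\ge1$ one has the bidiagonal factorization $T_m=L_{1,m}L_{2,m}U_m$, with $L_{1,m},L_{2,m},U_m$ built from these $a_n$ as in the context. Moreover, if $\alpha_1,\alpha_2>-1$ and $-1<\alpha_1-\alpha_2<0$, then $a_n>0$ for all $n\ge1$.
   Context: Matrices. Given sequences $(b_n)_{n\ge0},(c_n)_{n\ge1},(d_n)_{n\ge2}$, $T_m$ is the $m\times m$ matrix (rows and columns numbered from $1$) with $(T_m)_{i,i}=b_{i-1}$, $(T_m)_{i,i+1}=1$, $(T_m)_{i+1,i}=c_i$, $(T_m)_{i+2,i}=d_{i+1}$ and all other entries $0$. Given $(a_n)_{n\ge1}$: $L_{1,m}$ is the $m\times m$ lower bidiagonal matrix with $1$'s on the diagonal and $(L_{1,m})_{i+1,i}=a_{3i-1}$; $L_{2,m}$ is lower bidiagonal with $1$'s on the diagonal and $(L_{2,m})_{i+1,i}=a_{3i}$; $U_m$ is upper bidiagonal with diagonal entries $(U_m)_{i,i}=a_{3i-2}$ and $1$'s on the superdiagonal. Recurrence coefficients (multiple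 Laguerre of the first kind), $k\ge0$: $b_{2k}=3k+1+\alpha_1$; $b_{2k+1}=3k+2+\alpha_2$; $c_{2k}=k(3k+\alpha_1+\alpha_2)$; $c_{2k+1}=3k^2+k(\alpha_1+\alpha_2+3)+\alpha_1+1$; $d_{2k}=k(k+\alpha_1)(k+\alpha_1-\alpha_2)$; $d_{2k+1}=k(k+\alpha_2)(k+\alpha_2-\alpha_1)$. *)

theory Defs
  imports Complex_Main "Jordan_Normal_Form.Matrix"
begin

(* JNF matrices are indexed from 0, so the entry (i, j) below is the entry (i + 1, j + 1) in the
   1-based numbering in which
     T(i,i) = b(i-1),  T(i,i+1) = 1,  T(i+1,i) = c(i),  T(i+2,i) = d(i+1),
     L1(i+1,i) = a(3i-1),  L2(i+1,i) = a(3i),  U(i,i) = a(3i-2),  U(i,i+1) = 1. *)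

definition tetradiag_mat ::
    "(nat \<Rightarrow> real) \<Rightarrow> (nat \<Rightarrow> real) \<Rightarrow> (nat \<Rightarrow> real) \<Rightarrow> nat \<Rightarrow> real mat" where
  "tetradiag_mat b c d m = mat m m (\<lambda>(i, j).
     if i = j then b j
     else if j = i + 1 then 1
     else if i = j + 1 then c (j + 1)
     else if i = j + 2 then d (j + 2)
     else 0)"

definition L1_mat :: "(nat \<Rightarrow> real) \<Rightarrow> nat \<Rightarrow> real mat" where
  "L1_mat a m = mat m m (\<lambda>(i, j).
     if i = j then 1 else if i = j + 1 then a (3 * j + 2) else 0)"

definition L2_mat :: "(nat \<Rightarrow> real) \<Rightarrow> nat \<Rightarrow> real mat" where
  "L2_mat a m = mat m m (\<lambda>(i, j).
     if i = j then 1 else if i = j + 1 then a (3 * j + 3) else 0)"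

definition U_mat :: "(nat \<Rightarrow> real) \<Rightarrow> nat \<Rightarrow> real mat" where
  "U_mat a m = mat m m (\<lambda>(i, j).
     if i = j then a (3 * i + 1) else if j = i + 1 then 1 else 0)"

(* Recurrence coefficients of the multiple Laguerre polynomials of the first kind; k = n div 2.
   The values at c 0, d 0 and d 1 do not occur in tetradiag_mat. *)

definition laguerre_b :: "real \<Rightarrow> real \<Rightarrow> nat \<Rightarrow> real" where
  "laguerre_b \<alpha>1 \<alpha>2 n = (let k = real (n div 2) in
     if even n then 3 * k + 1 + \<alpha>1 else 3 * k + 2 + \<alpha>2)"

definition laguerre_c :: "real \<Rightarrow> real \<Rightarrow> nat \<Rightarrow> real" where
  "laguerre_c \<alpha>1 \<alpha>2 n = (let k = real (n div 2) in
     if even n then k * (3 * k + \<alpha>1 + \<alpha>2)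
     else 3 * k ^ 2 + k * (\<alpha>1 + \<alpha>2 + 3) + \<alpha>1 + 1)"

definition laguerre_d :: "real \<Rightarrow> real \<Rightarrow> nat \<Rightarrow> real" where
  "laguerre_d \<alpha>1 \<alpha>2 n = (let k = real (n div 2) in
     if even n then k * (k + \<alpha>1) * (k + \<alpha>1 - \<alpha>2)
     else k * (k + \<alpha>2) * (k + \<alpha>2 - \<alpha>1))"

(* The sequence starts at index 1; the value at 0 is irrelevant. For index 6 k + 6 the quotient
   by 6 is already k + 1. *)

definition laguerre_a :: "real \<Rightarrow> real \<Rightarrow> nat \<Rightarrow> real" where
  "laguerre_a \<alpha>1 \<alpha>2 n = (let k = real (n div 6) in
     if n mod 6 = 1 then \<alpha>1 + 1 + k
     else if n mod 6 = 2 then \<alpha>2 - \<alpha>1 + k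
     else if n mod 6 = 3 then \<alpha>1 - \<alpha>2 + k + 1
     else if n mod 6 = 4 then \<alpha>2 + 1 + k
     else if n mod 6 = 5 then k + 1
     else k)"

lemma laguerre_b_simps:
  "laguerre_b \<alpha>1 \<alpha>2 (2 * k) = 3 * real k + 1 + \<alpha>1"
  "laguerre_b \<alpha>1 \<alpha>2 (2 * k + 1) = 3 * real k + 2 + \<alpha>2"
  by (simp_all add: laguerre_b_def Let_def)

lemma laguerre_c_simps:
  "laguerre_c \<alpha>1 \<alpha>2 (2 * k) = real k * (3 * real k + \<alpha>1 + \<alpha>2)"
  "laguerre_c \<alpha>1 \<alpha>2 (2 * k + 1) = 3 * real k ^ 2 + real k * (\<alpha>1 + \<alpha>2 + 3) + \<alpha>1 + 1"
  by (simp_all add: laguerre_c_def Let_def)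

lemma laguerre_d_simps:
  "laguerre_d \<alpha>1 \<alpha>2 (2 * k) = real k * (real k + \<alpha>1) * (real k + \<alpha>1 - \<alpha>2)"
  "laguerre_d \<alpha>1 \<alpha>2 (2 * k + 1) = real k * (real k + \<alpha>2) * (real k + \<alpha>2 - \<alpha>1)"
  by (simp_all add: laguerre_d_def Let_def)

lemma laguerre_a_simps:
  "laguerre_a \<alpha>1 \<alpha>2 (6 * n + 1) = \<alpha>1 + 1 + real n"
  "laguerre_a \<alpha>1 \<alpha>2 (6 * n + 2) = \<alpha>2 - \<alpha>1 + real n"
  "laguerre_a \<alpha>1 \<alpha>2 (6 * n + 3) = \<alpha>1 - \<alpha>2 + real n + 1"
  "laguerre_a \<alpha>1 \<alpha>2 (6 * n + 4) = \<alpha>2 + 1 + real n"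
  "laguerre_a \<alpha>1 \<alpha>2 (6 * n + 5) = real n + 1"
  "laguerre_a \<alpha>1 \<alpha>2 (6 * n + 6) = real n + 1"
proof -
  have "(6 * n + 1) mod 6 = 1" "(6 * n + 1) div 6 = n" "(6 * n + 2) mod 6 = 2" "(6 * n + 2) div 6 = n"
    "(6 * n + 3) mod 6 = 3" "(6 * n + 3) div 6 = n" "(6 * n + 4) mod 6 = 4" "(6 * n + 4) div 6 = n"
    "(6 * n + 5) mod 6 = 5" "(6 * n + 5) div 6 = n" "(6 * n + 6) mod 6 = 0" "(6 * n + 6) div 6 = n + 1"
    by presburger+
  note eqs = this
  show
    "laguerre_a \<alpha>1 \<alpha>2 (6 * n + 1) = \<alpha>1 + 1 + real n"
    "laguerre_a \<alpha>1 \<alpha>2 (6 * n + 2) = \<alpha>2 - \<alpha>1 + real n"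
    "laguerre_a \<alpha>1 \<alpha>2 (6 * n + 3) = \<alpha>1 - \<alpha>2 + real n + 1"
    "laguerre_a \<alpha>1 \<alpha>2 (6 * n + 4) = \<alpha>2 + 1 + real n"
    "laguerre_a \<alpha>1 \<alpha>2 (6 * n + 5) = real n + 1"
    "laguerre_a \<alpha>1 \<alpha>2 (6 * n + 6) = real n + 1"
    unfolding laguerre_a_def Let_def eqs by simp_all
qed

end

theory Submission
  imports Defs
begin

text \<open>Multiplying by a bidiagonal matrix combines only two adjacent rows or columns, so the
  product of the three factors is tetradiagonal with unit superdiagonal. Comparing its three other
  diagonals with \<open>b\<close>, \<open>c\<close>, \<open>d\<close> gives a short list of scalar
  identities in \<open>a\<close>, valid for any sequences
  (\<open>tetradiag_mat_factorization\<close>). For the Laguerre data, \<open>a\<close> is given by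
  residues modulo 6 and each column uses up three indices, so the parity of the column decides which
  formulas apply; the identities then become polynomial ones in k, \<alpha>1, \<alpha>2. Positivity
  is read off residue by residue.\<close>

lemma L1_mat_mult_index:
  assumes "B \<in> carrier_mat m n" "i < m" "j < n"
  shows "(L1_mat a m * B) $$ (i, j) =
    B $$ (i, j) + (if i = 0 then 0 else a (3 * (i - 1) + 2) * B $$ (i - 1, j))"
proof -
  have "(L1_mat a m * B) $$ (i, j) = (\<Sum>k = 0..<m. L1_mat a m $$ (i, k) * B $$ (k, j))"
    using assms by (auto simp: L1_mat_def scalar_prod_def)
  \<comment> \<open>The row is split into two Kronecker deltas. As \<open>0 - 1 = 0\<close> on
    naturals, the guard \<open>i = 0\<close> is needed to keep the second delta from contributing in
    the top row.\<close>
  also have "\<dots> = (\<Sum>k = 0..<m. (if k = i then B $$ (k, j) else 0) +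
      (if k = i - 1 then (if i = 0 then 0 else a (3 * k + 2) * B $$ (k, j)) else 0))"
    using assms by (intro sum.cong) (auto simp: L1_mat_def)
  also have "\<dots> = B $$ (i, j) + (if i = 0 then 0 else a (3 * (i - 1) + 2) * B $$ (i - 1, j))"
    using assms by (simp add: sum.distrib)
  finally show ?thesis .
qed

lemma mult_U_mat_index:
  assumes "A \<in> carrier_mat n m" "i < n" "j < m"
  shows "(A * U_mat a m) $$ (i, j) =
    A $$ (i, j) * a (3 * j + 1) + (if j = 0 then 0 else A $$ (i, j - 1))"
proof -
  have "(A * U_mat a m) $$ (i, j) = (\<Sum>k = 0..<m. A $$ (i, k) * U_mat a m $$ (k, j))"
    using assms by (auto simp: U_mat_def scalar_prod_def)
  also have "\<dots> = (\<Sum>k = 0..<m. (if k = j then A $$ (i, k) * a (3 * k + 1) else 0) +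
      (if k = j - 1 then (if j = 0 then 0 else A $$ (i, k)) else 0))"
    using assms by (intro sum.cong) (auto simp: U_mat_def)
  also have "\<dots> = A $$ (i, j) * a (3 * j + 1) + (if j = 0 then 0 else A $$ (i, j - 1))"
    using assms by (simp add: sum.distrib)
  finally show ?thesis .
qed

text \<open>The entry two below the diagonal has a single source, the path through index
  \<open>j + 1\<close>, hence the mixed product of an \<open>L1_mat\<close> and an
  \<open>L2_mat\<close> entry.\<close>

lemma L1_mult_L2_index:
  assumes "i < m" "j < m"
  shows "(L1_mat a m * L2_mat a m) $$ (i, j) =
    (if i = j then 1
     else if i = j + 1 then a (3 * j + 2) + a (3 * j + 3)
     else if i = j + 2 then a (3 * j + 5) * a (3 * j + 3)
     else 0)"
proof -
  have "L2_mat a m \<in> carrier_mat m m"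
    by (simp add: L2_mat_def)
  note entry = L1_mat_mult_index[OF this assms, of a]
  have "a (3 * (j + 1) + 2) = a (3 * j + 5)"
    by (rule arg_cong[of _ _ a]) simp
  then show ?thesis
    using assms unfolding entry
    by (cases i) (auto simp: L2_mat_def)
qed

text \<open>Column 0 has no left neighbour, so \<open>b 0\<close> and \<open>c 1\<close> lose a term
  and are separate hypotheses. The lowest diagonal gets no contribution from that neighbour, so one
  formula for \<open>d\<close> covers all columns.\<close>

lemma tetradiag_mat_factorization:
  fixes a b c d :: "nat \<Rightarrow> real"
  assumes "b 0 = a 1"
    and "\<And>j. b (Suc j) = a (3 * j + 2) + a (3 * j + 3) + a (3 * j + 4)"
    and "c 1 = (a 2 + a 3) * a 1"
    and "\<And>j. c (j + 2) = (a (3 * j + 5) + a (3 * j + 6)) * a (3 * j + 4) + a (3 * j + 5) * a (3 * j + 3)"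
    and "\<And>j. d (j + 2) = a (3 * j + 5) * a (3 * j + 3) * a (3 * j + 1)"
  shows "tetradiag_mat b c d m = L1_mat a m * L2_mat a m * U_mat a m"
proof (rule eq_matI)
  fix i j
  assume "i < dim_row (L1_mat a m * L2_mat a m * U_mat a m)"
    and "j < dim_col (L1_mat a m * L2_mat a m * U_mat a m)"
  then have ij: "i < m" "j < m"
    by (simp_all add: L1_mat_def U_mat_def)
  have "L1_mat a m * L2_mat a m \<in> carrier_mat m m"
    by (simp add: L1_mat_def L2_mat_def carrier_matI)
  note entry = mult_U_mat_index[OF this ij, of a]
  have "tetradiag_mat b c d m $$ (i, j) =
      (L1_mat a m * L2_mat a m) $$ (i, j) * a (3 * j + 1) +
      (if j = 0 then 0 else (L1_mat a m * L2_mat a m) $$ (i, j - 1))"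
  proof (cases j)
    case 0
    then show ?thesis
      using ij assms(1,3) assms(5)[of 0]
      by (auto simp: tetradiag_mat_def L1_mult_L2_index numeral_2_eq_2)
  next
    case (Suc l)
    then show ?thesis
      using ij assms(2)[of l] assms(4)[of l] assms(5)[of j]
      by (auto simp: tetradiag_mat_def L1_mult_L2_index algebra_simps)
  qed
  then show "tetradiag_mat b c d m $$ (i, j) = (L1_mat a m * L2_mat a m * U_mat a m) $$ (i, j)"
    unfolding entry .
qed (simp_all add: tetradiag_mat_def L1_mat_def U_mat_def)

lemma laguerre_a_pos:
  assumes "\<alpha>1 > -1" "\<alpha>2 > -1" "-1 < \<alpha>1 - \<alpha>2" "\<alpha>1 - \<alpha>2 < 0" "n \<ge> 1"
  shows "laguerre_a \<alpha>1 \<alpha>2 n > 0"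
proof -
  \<comment> \<open>At residue 0 the value is the quotient itself, with no added 1, so
    \<open>n = 0\<close> must be excluded.\<close>
  have "n div 6 > 0" if "n mod 6 = 0"
    using that assms(5) by presburger
  then show ?thesis
    using assms(1-4) by (auto simp: laguerre_a_def Let_def intro: add_pos_nonneg)
qed

lemma laguerre_tetradiag_factorization:
  "tetradiag_mat (laguerre_b \<alpha>1 \<alpha>2) (laguerre_c \<alpha>1 \<alpha>2) (laguerre_d \<alpha>1 \<alpha>2) m =
    L1_mat (laguerre_a \<alpha>1 \<alpha>2) m * L2_mat (laguerre_a \<alpha>1 \<alpha>2) m * U_mat (laguerre_a \<alpha>1 \<alpha>2) m"
  (is "tetradiag_mat ?b ?c ?d m = L1_mat ?a m * _ * _")
proof (rule tetradiag_mat_factorization)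
  note simps = laguerre_a_simps[of \<alpha>1 \<alpha>2] laguerre_b_simps[of \<alpha>1 \<alpha>2]
    laguerre_c_simps[of \<alpha>1 \<alpha>2] laguerre_d_simps[of \<alpha>1 \<alpha>2]
  show "?b 0 = ?a 1" "?c 1 = (?a 2 + ?a 3) * ?a 1"
    using simps(1-3)[of 0] simps(7)[of 0] simps(10)[of 0] by (simp_all add: numeral_2_eq_2)
  fix j :: nat
  let ?rec = "?b (Suc j) = ?a (3 * j + 2) + ?a (3 * j + 3) + ?a (3 * j + 4) \<and>
    ?c (j + 2) = (?a (3 * j + 5) + ?a (3 * j + 6)) * ?a (3 * j + 4) + ?a (3 * j + 5) * ?a (3 * j + 3) \<and>
    ?d (j + 2) = ?a (3 * j + 5) * ?a (3 * j + 3) * ?a (3 * j + 1)"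
  have ?rec
  proof (cases "even j")
    case True
    then obtain k where j: "j = 2 * k"
      by (elim evenE)
    have index: "Suc j = 2 * k + 1" "j + 2 = 2 * (k + 1)"
      "3 * j + 1 = 6 * k + 1" "3 * j + 2 = 6 * k + 2" "3 * j + 3 = 6 * k + 3"
      "3 * j + 4 = 6 * k + 4" "3 * j + 5 = 6 * k + 5" "3 * j + 6 = 6 * k + 6"
      using j by simp_all
    show ?thesis
      unfolding index simps by (simp add: algebra_simps)
  next
    case False
    then obtain k where j: "j = 2 * k + 1"
      by (elim oddE)
    \<comment> \<open>For odd \<open>j\<close> the indices start at \<open>6 * k + 4\<close>, so
      from \<open>3 * j + 4\<close> on they run over into the next block of six.\<close>
    have index: "Suc j = 2 * (k + 1)" "j + 2 = 2 * (k + 1) + 1"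
      "3 * j + 1 = 6 * k + 4" "3 * j + 2 = 6 * k + 5" "3 * j + 3 = 6 * k + 6"
      "3 * j + 4 = 6 * (k + 1) + 1" "3 * j + 5 = 6 * (k + 1) + 2" "3 * j + 6 = 6 * (k + 1) + 3"
      using j by simp_all
    show ?thesis
      unfolding index simps by (simp add: algebra_simps power2_eq_square)
  qed
  then show "?b (Suc j) = ?a (3 * j + 2) + ?a (3 * j + 3) + ?a (3 * j + 4)"
    and "?c (j + 2) = (?a (3 * j + 5) + ?a (3 * j + 6)) * ?a (3 * j + 4) + ?a (3 * j + 5) * ?a (3 * j + 3)"
    and "?d (j + 2) = ?a (3 * j + 5) * ?a (3 * j + 3) * ?a (3 * j + 1)"
    by blast+
qed

theorem proposition3p6:
  fixes \<alpha>1 \<alpha>2 :: real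
  shows "(\<forall>m\<ge>1. tetradiag_mat (laguerre_b \<alpha>1 \<alpha>2) (laguerre_c \<alpha>1 \<alpha>2) (laguerre_d \<alpha>1 \<alpha>2) m
            = L1_mat (laguerre_a \<alpha>1 \<alpha>2) m * L2_mat (laguerre_a \<alpha>1 \<alpha>2) m * U_mat (laguerre_a \<alpha>1 \<alpha>2) m) \<and>
         (\<alpha>1 > -1 \<and> \<alpha>2 > -1 \<and> -1 < \<alpha>1 - \<alpha>2 \<and> \<alpha>1 - \<alpha>2 < 0 \<longrightarrow>
            (\<forall>n\<ge>1. laguerre_a \<alpha>1 \<alpha>2 n > 0))"
  using laguerre_tetradiag_factorization laguerre_a_pos by blast

end
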